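(* For every integer $r$ with $0\le r<N_t-1$, $$\bm L_\ell=\bm K_{\ell,N_t-1}\preceq\bm K_{\ell,r+1}\preceq\bm K_{\ell,r}\preceq\bm K_{\ell,0}=\lambda_{\ell,1}\bm I_{N_t}.$$
   Context: $\bm L_\ell\in\mathbb C^{N_t\times N_t}$ is a Hermitian positive semidefinite matrix, namely the transmit curvature matrix $\bm L_\ell=\sum_{i=1}^{L}\sum_{j=1}^{K}w_{ij}\bm H_{ij,\ell}^H\bm Y_{ij}(\bm I_d+\bm\Gamma_{ij})\bm Y_{ij}^H\bm H_{ij,\ell}$ with weights $w_{ij}\ge0$, channels $\bm H_{ij,\ell}\in\mathbb C^{N_r\times N_t}$, $\bm Y_{ij}\in\mathbb C^{N_r\times d}$, and Hermitian positive semidefinite $\bm\Gamma_{ij}\in\mathbb C^{d\times d}$. Let $\bm L_\ell=\bm U_\ell\,\mathrm{diag}(\lambda_{\ell,1},\dots,\lambda_{\ell,N_t})\bm U_\ell^H$ be an eigendecomposition with $\bm U_\ell$ unitary and $\lambda_{\ell,1}\ge\lambda_{\ell,2}\ge\cdots\ge\lambda_{\ell,N_t}\ge0$. For $0\le r\le N_t-1$ put $\beta_{\ell,r}=\lambda_{\ell,r+1}$ and define the rank-$r$ spectral majorizer $$\bm K_{\ell,r}=\bm U_\ell\,\mathrm{diag}(\lambda_{\ell,1},\dots,\lambda_{\ell,r},\underbrace{\beta_{\ell,r},\dots,\beta_{\ell,r}}_{N_t-r})\bm U_\ell^H .$$ The symbol $\preceq$ denotes the Loewner order on Hermitian matrices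 ($\bm A\preceq\bm B$ iff $\bm B-\bm A$ is positive semidefinite). *)

theory Defs
  imports "Jordan_Normal_Form.Schur_Decomposition"
begin

definition hermitian_mat :: "nat \<Rightarrow> complex mat \<Rightarrow> bool" where
  "hermitian_mat n A \<longleftrightarrow> A \<in> carrier_mat n n \<and> mat_adjoint A = A"

definition unitary_mat :: "nat \<Rightarrow> complex mat \<Rightarrow> bool" where
  "unitary_mat n U \<longleftrightarrow> U \<in> carrier_mat n n \<and>
     mat_adjoint U * U = 1\<^sub>m n \<and> U * mat_adjoint U = 1\<^sub>m n"

(* Since v \<bullet>c w conjugates w, the scalar (A *\<^sub>v v) \<bullet>c v is the quadratic form v^H A v.
   The order on complex makes 0 \<le> z say that z is real and nonnegative. *)
definition psd_mat :: "nat \<Rightarrow> complex mat \<Rightarrow> bool" where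
  "psd_mat n A \<longleftrightarrow> hermitian_mat n A \<and>
     (\<forall>v \<in> carrier_vec n. 0 \<le> (A *\<^sub>v v) \<bullet>c v)"

definition loewner_le :: "nat \<Rightarrow> complex mat \<Rightarrow> complex mat \<Rightarrow> bool" where
  "loewner_le n A B \<longleftrightarrow> hermitian_mat n A \<and> hermitian_mat n B \<and> psd_mat n (B - A)"

(* The matrix type has no zero independent of the dimensions, so the sum over i and j
   of w_ij H_ijl^H Y_ij (I_d + Gamma_ij) Y_ij^H H_ijl is taken entry by entry. *)
definition curvature_mat ::
  "nat \<Rightarrow> nat \<Rightarrow> nat \<Rightarrow> nat \<Rightarrow> (nat \<Rightarrow> nat \<Rightarrow> real) \<Rightarrow> (nat \<Rightarrow> nat \<Rightarrow> nat \<Rightarrow> complex mat) \<Rightarrow>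
   (nat \<Rightarrow> nat \<Rightarrow> complex mat) \<Rightarrow> (nat \<Rightarrow> nat \<Rightarrow> complex mat) \<Rightarrow> nat \<Rightarrow> complex mat" where
  "curvature_mat L K Nt d w H Y \<Gamma> l = mat Nt Nt (\<lambda>(a, b).
     \<Sum>i = 1..L. \<Sum>j = 1..K.
       (complex_of_real (w i j) \<cdot>\<^sub>m
         (mat_adjoint (H i j l) * Y i j * (1\<^sub>m d + \<Gamma> i j) * mat_adjoint (Y i j) * H i j l)) $$ (a, b))"

(* The eigenvalues are lam 1, ..., lam n, whereas matrix indices start at 0. *)
definition ordered_eigendecomposition ::
  "nat \<Rightarrow> complex mat \<Rightarrow> complex mat \<Rightarrow> (nat \<Rightarrow> real) \<Rightarrow> bool" where
  "ordered_eigendecomposition n A U lam \<longleftrightarrow>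
     unitary_mat n U \<and>
     A = U * mat_diag n (\<lambda>k. complex_of_real (lam (k + 1))) * mat_adjoint U \<and>
     (\<forall>i j. 1 \<le> i \<and> i \<le> j \<and> j \<le> n \<longrightarrow> lam j \<le> lam i) \<and>
     (\<forall>i. 1 \<le> i \<and> i \<le> n \<longrightarrow> 0 \<le> lam i)"

definition spectral_majorizer ::
  "nat \<Rightarrow> complex mat \<Rightarrow> (nat \<Rightarrow> real) \<Rightarrow> nat \<Rightarrow> complex mat" where
  "spectral_majorizer n U lam r =
     (let \<beta> = lam (r + 1) in
      U * mat_diag n (\<lambda>k. complex_of_real (if k < r then lam (k + 1) else \<beta>)) * mat_adjoint U)"

end

theory Submission
  imports Defs
begin

text \<open>
  The matrices \<open>K\<^sub>r\<close> are conjugates \<open>U D\<^sub>r U\<^sup>H\<close> of real diagonal matrices by one and the same \<open>U\<close>, and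
  \<open>v\<^sup>H U D U\<^sup>H v = \<Sum>\<^sub>k D\<^sub>k |(U\<^sup>H v)\<^sub>k|\<^sup>2\<close>. So the Loewner order between them follows from the entrywise
  order of the diagonals, which is clear since \<open>D\<^sub>r\<close> has \<open>k\<close>-th entry \<open>\<lambda>\<^bsub>min(k, r+1)\<^esub>\<close>
  and \<open>\<lambda>\<close> is decreasing.
\<close>

lemma mat_adjoint_carrier [simp]: "A \<in> carrier_mat nr nc \<Longrightarrow> mat_adjoint A \<in> carrier_mat nc nr"
  unfolding mat_adjoint_def by auto

lemma dim_mat_adjoint [simp]:
  "dim_row (mat_adjoint A) = dim_col A" "dim_col (mat_adjoint A) = dim_row A"
  unfolding mat_adjoint_def by auto

lemma mat_adjoint_index [simp]:
  "i < dim_col A \<Longrightarrow> j < dim_row A \<Longrightarrow> mat_adjoint A $$ (i, j) = conjugate (A $$ (j, i))"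
  unfolding mat_adjoint_def by (auto simp: mat_of_rows_def)

text \<open>Both sides expand to the same double sum, read in the two orders. It carries the outer
  \<open>U\<close> of the quadratic form over to the second argument, where it becomes the
  adjoint.\<close>

lemma mult_mat_vec_cscalar_prod:
  fixes A :: "complex mat"
  assumes A: "A \<in> carrier_mat nr nc" and x: "x \<in> carrier_vec nc" and y: "y \<in> carrier_vec nr"
  shows "(A *\<^sub>v x) \<bullet>c y = x \<bullet>c (mat_adjoint A *\<^sub>v y)"
proof -
  have "(A *\<^sub>v x) \<bullet>c y = (\<Sum>i<nr. \<Sum>j<nc. A $$ (i, j) * x $ j * cnj (y $ i))"
    using A x y by (simp add: scalar_prod_def atLeast0LessThan sum_distrib_right)
  also have "\<dots> = (\<Sum>j<nc. \<Sum>i<nr. A $$ (i, j) * x $ j * cnj (y $ i))"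
    by (rule sum.swap)
  also have "\<dots> = x \<bullet>c (mat_adjoint A *\<^sub>v y)"
    using A x y
    by (simp add: scalar_prod_def atLeast0LessThan sum_distrib_left mult_ac)
  finally show ?thesis .
qed

text \<open>Common form of the curvature matrix and all its majorizers over one fixed
  \<open>U\<close>. The diagonal is real-valued, so conjugation fixes it and diagonals can be
  compared entrywise.\<close>

definition spectral_mat :: "nat \<Rightarrow> complex mat \<Rightarrow> (nat \<Rightarrow> real) \<Rightarrow> complex mat" where
  "spectral_mat n U f = U * mat_diag n (\<lambda>k. complex_of_real (f k)) * mat_adjoint U"

lemma spectral_mat_carrier [simp]: "U \<in> carrier_mat n n \<Longrightarrow> spectral_mat n U f \<in> carrier_mat n n"
  unfolding spectral_mat_def by (meson mat_adjoint_carrier mat_diag_dim mult_carrier_mat)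

lemma spectral_mat_cong:
  assumes "\<And>k. k < n \<Longrightarrow> f k = g k"
  shows "spectral_mat n U f = spectral_mat n U g"
proof -
  have "mat_diag n (\<lambda>k. complex_of_real (f k)) = mat_diag n (\<lambda>k. complex_of_real (g k))"
    using assms by (auto simp: mat_diag_def)
  then show ?thesis by (simp add: spectral_mat_def)
qed

lemma spectral_mat_index:
  assumes U: "U \<in> carrier_mat n n" and "i < n" "j < n"
  shows "spectral_mat n U f $$ (i, j) = (\<Sum>k<n. U $$ (i, k) * of_real (f k) * cnj (U $$ (j, k)))"
  unfolding spectral_mat_def
  using assms
  by (simp add: mat_diag_mult_right[OF U] scalar_prod_def atLeast0LessThan)

text \<open>Conjugating the entry sum and exchanging i and j swaps the two factors from
  \<open>U\<close> and leaves the real \<open>f k\<close> alone.\<close>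

lemma hermitian_spectral_mat:
  assumes U: "U \<in> carrier_mat n n"
  shows "hermitian_mat n (spectral_mat n U f)"
proof -
  let ?S = "spectral_mat n U f"
  have S: "?S \<in> carrier_mat n n" using U by simp
  have "mat_adjoint ?S = ?S"
  proof (rule eq_matI)
    fix i j assume "i < dim_row ?S" "j < dim_col ?S"
    then have "i < n" "j < n" using S by auto
    then show "mat_adjoint ?S $$ (i, j) = ?S $$ (i, j)"
      using S by (simp add: spectral_mat_index[OF U] mult_ac)
  qed (use S in auto)
  with S show ?thesis by (simp add: hermitian_mat_def)
qed

text \<open>The entries are linear in the diagonal. A Loewner comparison thus becomes positivity of
  a single \<open>spectral_mat\<close>.\<close>

lemma spectral_mat_minus:
  assumes U: "U \<in> carrier_mat n n"
  shows "spectral_mat n U f - spectral_mat n U g = spectral_mat n U (\<lambda>k. f k - g k)"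
proof (rule eq_matI)
  let ?S = "spectral_mat n U (\<lambda>k. f k - g k)"
  fix i j assume "i < dim_row ?S" "j < dim_col ?S"
  then have "i < n" "j < n" using spectral_mat_carrier[OF U, of "\<lambda>k. f k - g k"] by auto
  then show "(spectral_mat n U f - spectral_mat n U g) $$ (i, j) = ?S $$ (i, j)"
    using spectral_mat_carrier[OF U, of f] spectral_mat_carrier[OF U, of g]
    by (simp add: spectral_mat_index[OF U] algebra_simps sum_subtractf)
qed (use spectral_mat_carrier[OF U, of g] spectral_mat_carrier[OF U, of "\<lambda>k. f k - g k"] in auto)

lemma mat_diag_cscalar_prod:
  fixes x :: "complex vec"
  assumes x: "x \<in> carrier_vec n"
  shows "(mat_diag n f *\<^sub>v x) \<bullet>c x = (\<Sum>k<n. f k * (x $ k * cnj (x $ k)))"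
proof -
  have "(mat_diag n f *\<^sub>v x) $ k = f k * x $ k" if "k < n" for k
  proof -
    have "(mat_diag n f *\<^sub>v x) $ k = (\<Sum>j<n. (if k = j then f j else 0) * x $ j)"
      using x that by (simp add: mat_diag_def scalar_prod_def atLeast0LessThan)
    \<comment> \<open>With the product inside the conditional, the sum collapses to its only nonzero
      term, j = k.\<close>
    also have "\<dots> = (\<Sum>j<n. if k = j then f j * x $ j else 0)"
      by (rule sum.cong) auto
    finally show ?thesis using that by simp
  qed
  moreover have "mat_diag n f *\<^sub>v x \<in> carrier_vec n"
    using mult_mat_vec_carrier[OF mat_diag_dim x] .
  ultimately show ?thesis
    using x by (simp add: scalar_prod_def atLeast0LessThan mult_ac)
qed

lemma psd_spectral_mat:
  assumes U: "U \<in> carrier_mat n n" and f: "\<And>k. k < n \<Longrightarrow> 0 \<le> f k"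
  shows "psd_mat n (spectral_mat n U f)"
  unfolding psd_mat_def
proof (intro conjI ballI)
  fix v :: "complex vec" assume v: "v \<in> carrier_vec n"
  let ?D = "mat_diag n (\<lambda>k. complex_of_real (f k))"
  let ?x = "mat_adjoint U *\<^sub>v v"
  have D: "?D \<in> carrier_mat n n" by simp
  have A: "mat_adjoint U \<in> carrier_mat n n" using U by simp
  have x: "?x \<in> carrier_vec n" using A v by simp
  have "spectral_mat n U f *\<^sub>v v = U *\<^sub>v (?D *\<^sub>v ?x)"
    unfolding spectral_mat_def
    using assoc_mult_mat_vec[OF mult_carrier_mat[OF U D] A v] assoc_mult_mat_vec[OF U D x] by simp
  then have "(spectral_mat n U f *\<^sub>v v) \<bullet>c v = (?D *\<^sub>v ?x) \<bullet>c ?x"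
    using mult_mat_vec_cscalar_prod[OF U mult_mat_vec_carrier[OF D x] v] by simp
  also have "\<dots> = (\<Sum>k<n. of_real (f k) * (?x $ k * cnj (?x $ k)))"
    by (rule mat_diag_cscalar_prod[OF x])
  \<comment> \<open>Since z * cnj z = |z|^2, the form is the image of a real sum. This settles the
    imaginary part that the order on \<open>complex\<close> also constrains, and leaves real
    nonnegativity.\<close>
  also have "\<dots> = of_real (\<Sum>k<n. f k * (cmod (?x $ k))\<^sup>2)"
    by (simp only: complex_norm_square[symmetric] of_real_sum of_real_mult)
  also have "0 \<le> \<dots>"
    using f by (auto simp: less_eq_complex_def intro!: sum_nonneg)
  finally show "0 \<le> (spectral_mat n U f *\<^sub>v v) \<bullet>c v" .
qed (rule hermitian_spectral_mat[OF U])

lemma loewner_le_spectral_mat: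
  assumes U: "U \<in> carrier_mat n n" and "\<And>k. k < n \<Longrightarrow> f k \<le> g k"
  shows "loewner_le n (spectral_mat n U f) (spectral_mat n U g)"
  unfolding loewner_le_def
  using assms by (simp add: hermitian_spectral_mat spectral_mat_minus psd_spectral_mat)

text \<open>A constant diagonal scales every column of \<open>U\<close> by \<open>c\<close>, so the
  product is c U U^H, and unitarity finishes.\<close>

lemma spectral_mat_const:
  assumes "unitary_mat n U"
  shows "spectral_mat n U (\<lambda>_. c) = complex_of_real c \<cdot>\<^sub>m 1\<^sub>m n"
proof -
  have U: "U \<in> carrier_mat n n" and UU: "U * mat_adjoint U = 1\<^sub>m n"
    using assms by (auto simp: unitary_mat_def)
  have "U * mat_diag n (\<lambda>_. complex_of_real c) = complex_of_real c \<cdot>\<^sub>m U"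
    unfolding mat_diag_mult_right[OF U] using U by (auto intro!: eq_matI)
  then show ?thesis
    unfolding spectral_mat_def
    using UU mult_smult_assoc_mat[OF U mat_adjoint_carrier[OF U]] by simp
qed

text \<open>Capping the index at \<open>r\<close> replaces the case split and makes the dependence
  on \<open>r\<close> monotone. The \<open>+ 1\<close> converts positions counted from 0 to
  eigenvalues counted from 1.\<close>

lemma spectral_majorizer_eq_spectral_mat:
  "spectral_majorizer n U lam r = spectral_mat n U (\<lambda>k. lam (min k r + 1))"
proof -
  have "(if k < r then lam (k + 1) else lam (r + 1)) = lam (min k r + 1)" for k
    by (simp add: min_def)
  then show ?thesis by (simp only: spectral_majorizer_def spectral_mat_def Let_def)
qed

text \<open>Raising the cap can only raise the index, and \<open>lam\<close> decreases. All three
  comparisons of the chain are instances.\<close>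

lemma spectral_majorizer_antimono:
  assumes "ordered_eigendecomposition n A U lam" and "r \<le> s"
  shows "loewner_le n (spectral_majorizer n U lam s) (spectral_majorizer n U lam r)"
  unfolding spectral_majorizer_eq_spectral_mat
proof (rule loewner_le_spectral_mat)
  show "U \<in> carrier_mat n n"
    using assms by (simp add: ordered_eigendecomposition_def unitary_mat_def)
  show "lam (min k s + 1) \<le> lam (min k r + 1)" if "k < n" for k
  proof -
    \<comment> \<open>The ordering of \<open>lam\<close> is only given on 1..n. The bound min k s <=
      k < n keeps both indices there for every \<open>s\<close>.\<close>
    have "1 \<le> min k r + 1" "min k r + 1 \<le> min k s + 1" "min k s + 1 \<le> n"
      using assms(2) that by auto
    then show ?thesis using assms(1) unfolding ordered_eigendecomposition_def by blast
  qed
qed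

theorem proposition1:
  fixes L K Nt Nr d l r :: nat
    and w :: "nat \<Rightarrow> nat \<Rightarrow> real"
    and H :: "nat \<Rightarrow> nat \<Rightarrow> nat \<Rightarrow> complex mat"
    and Y \<Gamma> :: "nat \<Rightarrow> nat \<Rightarrow> complex mat"
    and U :: "nat \<Rightarrow> complex mat"
    and lam :: "nat \<Rightarrow> nat \<Rightarrow> real"
  assumes "\<And>i j. i \<in> {1..L} \<Longrightarrow> j \<in> {1..K} \<Longrightarrow> 0 \<le> w i j"
    and "\<And>i j. i \<in> {1..L} \<Longrightarrow> j \<in> {1..K} \<Longrightarrow> H i j l \<in> carrier_mat Nr Nt"
    and "\<And>i j. i \<in> {1..L} \<Longrightarrow> j \<in> {1..K} \<Longrightarrow> Y i j \<in> carrier_mat Nr d"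
    and "\<And>i j. i \<in> {1..L} \<Longrightarrow> j \<in> {1..K} \<Longrightarrow> psd_mat d (\<Gamma> i j)"
    and "ordered_eigendecomposition Nt (curvature_mat L K Nt d w H Y \<Gamma> l) (U l) (lam l)"
    and "r < Nt - 1"
  shows "curvature_mat L K Nt d w H Y \<Gamma> l = spectral_majorizer Nt (U l) (lam l) (Nt - 1)
    \<and> loewner_le Nt (spectral_majorizer Nt (U l) (lam l) (Nt - 1)) (spectral_majorizer Nt (U l) (lam l) (r + 1))
    \<and> loewner_le Nt (spectral_majorizer Nt (U l) (lam l) (r + 1)) (spectral_majorizer Nt (U l) (lam l) r)
    \<and> loewner_le Nt (spectral_majorizer Nt (U l) (lam l) r) (spectral_majorizer Nt (U l) (lam l) 0)
    \<and> spectral_majorizer Nt (U l) (lam l) 0 = complex_of_real (lam l 1) \<cdot>\<^sub>m 1\<^sub>m Nt"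
proof -
  let ?A = "curvature_mat L K Nt d w H Y \<Gamma> l"
  note eig = assms(5)
  have "?A = spectral_mat Nt (U l) (\<lambda>k. lam l (k + 1))"
    using eig by (simp add: ordered_eigendecomposition_def spectral_mat_def)
  \<comment> \<open>For k < Nt the cap Nt - 1 has no effect: the only entry replaced is the last,
    and it is replaced by itself.\<close>
  also have "\<dots> = spectral_majorizer Nt (U l) (lam l) (Nt - 1)"
    unfolding spectral_majorizer_eq_spectral_mat by (rule spectral_mat_cong) (auto simp: min_def)
  finally have "?A = spectral_majorizer Nt (U l) (lam l) (Nt - 1)" .
  \<comment> \<open>At rank 0 the cap sends every index to the first eigenvalue, so the diagonal is
    constant.\<close>
  moreover have "spectral_majorizer Nt (U l) (lam l) 0 = complex_of_real (lam l 1) \<cdot>\<^sub>m 1\<^sub>m Nt"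
    using eig spectral_mat_const[of Nt "U l" "lam l 1"]
    by (simp add: ordered_eigendecomposition_def spectral_majorizer_eq_spectral_mat)
  ultimately show ?thesis
    \<comment> \<open>The rank inequalities left over are r + 1 <= Nt - 1, r <= r + 1 and 0 <= r;
      the first is the range assumption on \<open>r\<close>.\<close>
    using assms(6) by (intro conjI spectral_majorizer_antimono[OF eig]) simp_all
qed

end
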